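(* Let $\mathcal{H}$ be a complex Hilbert space, let $A \in \mathscr{B}(\mathcal{H})$ be a compact normal operator with canonical decomposition $A = \sum_{n \in S} \lambda_n P_n$ (as fixed in the context), and let $g \in \mathcal{H}$. Then $$\overline{\mathcal{K}(A,g)} = \overline{\mathrm{span}\{P_n g \mid n \in S\}}.$$
   Context: $\mathscr{B}(\mathcal{H})$ denotes the bounded everywhere defined linear operators on $\mathcal{H}$, and bars over subspaces denote norm closure in $\mathcal{H}$. For $A \in \mathscr{B}(\mathcal{H})$ and $g \in \mathcal{H}$ the Krylov subspace is $\mathcal{K}(A,g) := \mathrm{span}\{A^k g \mid k \in \mathbb{N}_0\}$. Canonical decomposition of a compact normal operator $A$: $A = \sum_{n \in S} \lambda_n P_n$ with convergence in operator norm, where $S \subset \mathbb{N}_0$ is an index set with $0 \in S$; $(\lambda_n)_{n \in S \setminus \{0\}}$ are the distinct non-zero eigenvalues of $A$ (with $\lambda_n \to 0$ as $n \to \infty$ if $S$ is infinite); $\lambda_0 = 0$, which need not be an eigenvalue of $A$; for $n \in S\setminus\{0\}$, $P_n$ is the orthogonal projection onto the eigenspace $\ker(A - \lambda_n)$ (equivalently, the Riesz projection of $A$ associated with the isolated spectral point $\lambda_n$); $P_0$ is the orthogonal projection onto $\ker A$ (so $P_0 = 0$ when $A$ is injective). The $P_n$ are mutually orthogonal and $\sum_{n \in S} P_n$ equals the identity, with convergence in the strong operator topology. *)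

theory Defs
  imports "HOL-Analysis.Analysis"
begin

class scaleC =
  fixes scaleC :: "complex \<Rightarrow> 'a \<Rightarrow> 'a" (infixr \<open>*\<^sub>C\<close> 75)

text \<open>
  A complex Hilbert space. Norm, completeness and topology come from the underlying real inner
  product space, whose inner product is the real part of the complex one; hence
  \<open>(norm x)\<^sup>2 = Re (cinner x x)\<close>, and positive definiteness of \<open>cinner\<close> is inherited.
  The complex inner product is linear in the second argument.
\<close>

class complex_hilbert_space = real_inner + complete_space + scaleC +
  fixes cinner :: "'a \<Rightarrow> 'a \<Rightarrow> complex"
  assumes scaleC_add_right: "c *\<^sub>C (x + y) = c *\<^sub>C x + c *\<^sub>C y"
    and scaleC_add_left: "(c + d) *\<^sub>C x = c *\<^sub>C x + d *\<^sub>C x"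
    and scaleC_scaleC: "c *\<^sub>C d *\<^sub>C x = (c * d) *\<^sub>C x"
    and scaleC_one: "1 *\<^sub>C x = x"
    and scaleR_scaleC: "r *\<^sub>R x = complex_of_real r *\<^sub>C x"
    and cinner_commute: "cinner x y = cnj (cinner y x)"
    and cinner_add_right: "cinner x (y + z) = cinner x y + cinner x z"
    and cinner_scaleC_right: "cinner x (c *\<^sub>C y) = c * cinner x y"
    and inner_eq_Re_cinner: "inner x y = Re (cinner x y)"

interpretation complex_vector:
  vector_space "scaleC :: complex \<Rightarrow> 'a \<Rightarrow> 'a::complex_hilbert_space"
  by standard (simp_all add: scaleC_add_right scaleC_add_left scaleC_scaleC scaleC_one)

abbreviation cspan :: "'a::complex_hilbert_space set \<Rightarrow> 'a set"
  where "cspan \<equiv> complex_vector.span"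

definition bounded_clinear :: "('a::complex_hilbert_space \<Rightarrow> 'a) \<Rightarrow> bool"
  where "bounded_clinear A \<longleftrightarrow> bounded_linear A \<and> (\<forall>c x. A (c *\<^sub>C x) = c *\<^sub>C A x)"

definition compact_operator :: "('a::complex_hilbert_space \<Rightarrow> 'a) \<Rightarrow> bool"
  where "compact_operator A \<longleftrightarrow> bounded_clinear A \<and> compact (closure (A ` cball 0 1))"

definition is_cadjoint ::
    "('a::complex_hilbert_space \<Rightarrow> 'a) \<Rightarrow> ('a \<Rightarrow> 'a) \<Rightarrow> bool"
  where "is_cadjoint B A \<longleftrightarrow> (\<forall>x y. cinner (B x) y = cinner x (A y))"

text \<open>
  The adjoint of a bounded operator exists and is unique, so the quantifier below only names it.
\<close>

definition normal_operator :: "('a::complex_hilbert_space \<Rightarrow> 'a) \<Rightarrow> bool"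
  where "normal_operator A \<longleftrightarrow>
    bounded_clinear A \<and> (\<exists>B. is_cadjoint B A \<and> A \<circ> B = B \<circ> A)"

definition eigenspace :: "('a::complex_hilbert_space \<Rightarrow> 'a) \<Rightarrow> complex \<Rightarrow> 'a set"
  where "eigenspace A c = {x. A x = c *\<^sub>C x}"

definition eigenvalue :: "('a::complex_hilbert_space \<Rightarrow> 'a) \<Rightarrow> complex \<Rightarrow> bool"
  where "eigenvalue A c \<longleftrightarrow> (\<exists>x \<in> eigenspace A c. x \<noteq> 0)"

definition is_orthogonal_projection ::
    "('a::complex_hilbert_space \<Rightarrow> 'a) \<Rightarrow> 'a set \<Rightarrow> bool"
  where "is_orthogonal_projection P M \<longleftrightarrow>
    (\<forall>x. P x \<in> M \<and> (\<forall>y \<in> M. cinner y (x - P x) = 0))"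

text \<open>
  The canonical decomposition of \<open>A\<close> as the operator-norm convergent sum of \<open>\<lambda>\<^sub>n P\<^sub>n\<close> over \<open>n \<in> S\<close>.
  The values of \<open>lam\<close> and \<open>P\<close> outside \<open>S\<close> are irrelevant. Since \<open>lam 0 = 0\<close>, the requirement on
  \<open>P 0\<close> says that it projects onto the kernel of \<open>A\<close>. Mutual orthogonality of the \<open>P n\<close>
  and their strong convergence to the identity are not required, since they follow.
\<close>

definition canonical_decomposition ::
    "('a::complex_hilbert_space \<Rightarrow> 'a) \<Rightarrow> nat set \<Rightarrow> (nat \<Rightarrow> complex) \<Rightarrow> (nat \<Rightarrow> 'a \<Rightarrow> 'a) \<Rightarrow> bool"
  where "canonical_decomposition A S lam P \<longleftrightarrow>
    0 \<in> S \<and> lam 0 = 0 \<and>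
    bij_betw lam (S - {0}) {c. c \<noteq> 0 \<and> eigenvalue A c} \<and>
    (infinite S \<longrightarrow> (lam \<longlongrightarrow> 0) (inf sequentially (principal S))) \<and>
    (\<forall>n \<in> S. is_orthogonal_projection (P n) (eigenspace A (lam n))) \<and>
    (\<lambda>N. onorm (\<lambda>x. A x - (\<Sum>n \<in> S \<inter> {..N}. lam n *\<^sub>C P n x))) \<longlonglongrightarrow> 0"

definition krylov :: "('a::complex_hilbert_space \<Rightarrow> 'a) \<Rightarrow> 'a \<Rightarrow> 'a set"
  where "krylov A g = cspan {(A ^^ k) g | k. True}"

end

theory Submission imports Defs begin

text \<open>
  Normality makes every eigenvector of \<open>A\<close> an eigenvector of the adjoint, so the eigenspaces are
  mutually orthogonal and the projections \<open>P\<^sub>n\<close> satisfy \<open>P\<^sub>n A = \<lambda>\<^sub>n P\<^sub>n\<close>. By Bessel's inequality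
  \<open>\<Sum>\<^sub>n P\<^sub>n x\<close> converges; its difference from \<open>x\<close> is annihilated by \<open>A\<close> and by \<open>P\<^sub>0\<close>, hence is \<open>0\<close>.
  Applied to \<open>A\<^sup>k g\<close>, this gives one inclusion. Conversely, let \<open>M\<close> be a closed \<open>A\<close>-invariant
  subspace, \<open>x \<in> M\<close> and \<open>\<lambda>\<^sub>m \<noteq> 0\<close>. Applying a polynomial in \<open>A\<close> removes from \<open>x\<close> the finitely many
  components with \<open>\<bar>\<lambda>\<^sub>j\<bar> \<ge> \<bar>\<lambda>\<^sub>m\<bar>\<close>, \<open>j \<noteq> m\<close>, while preserving \<open>P\<^sub>m x\<close>; then \<open>\<lambda>\<^sub>m\<^sup>-\<^sup>k A\<^sup>k\<close> applied to the
  result tends to \<open>P\<^sub>m x\<close>, which therefore lies in \<open>M\<close>. The case \<open>m = 0\<close> follows by subtraction.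
\<close>

section \<open>Complex inner product and norm\<close>

lemma cinner_add_left: "cinner (x + y) z = cinner x z + cinner (y::'a::complex_hilbert_space) z"
  by (metis cinner_add_right cinner_commute complex_cnj_add)

lemma cinner_scaleC_left: "cinner (c *\<^sub>C x) y = cnj c * cinner (x::'a::complex_hilbert_space) y"
  by (metis cinner_commute cinner_scaleC_right complex_cnj_mult)

lemma additive_cinner_right: "Modules.additive (cinner (x::'a::complex_hilbert_space))"
  by standard (rule cinner_add_right)

lemma additive_cinner_left: "Modules.additive (\<lambda>x. cinner x (y::'a::complex_hilbert_space))"
  by standard (rule cinner_add_left)

lemmas cinner_zero_right [simp] = Modules.additive.zero[OF additive_cinner_right]
  and cinner_zero_left [simp] = Modules.additive.zero[OF additive_cinner_left]
  and cinner_diff_right = Modules.additive.diff[OF additive_cinner_right]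
  and cinner_diff_left = Modules.additive.diff[OF additive_cinner_left]
  and cinner_sum_left = Modules.additive.sum[OF additive_cinner_left]

text \<open>The norm comes from the real inner product, which is the real part of
  \<open>cinner\<close>; conjugate symmetry makes the imaginary part of \<open>cinner x x\<close>
  vanish.\<close>

lemma cinner_self: "cinner x x = complex_of_real ((norm (x::'a::complex_hilbert_space))\<^sup>2)"
proof -
  have "Im (cinner x x) = 0"
    using arg_cong[OF cinner_commute[of x x], of Im] by simp
  moreover have "Re (cinner x x) = (norm x)\<^sup>2"
    by (simp flip: inner_eq_Re_cinner add: dot_square_norm)
  ultimately show ?thesis
    by (simp add: complex_eq_iff)
qed

lemma cinner_self_eq_0_iff: "cinner x x = 0 \<longleftrightarrow> (x::'a::complex_hilbert_space) = 0"
  by (simp add: cinner_self)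

lemma norm_scaleC: "norm (c *\<^sub>C x) = cmod c * norm (x::'a::complex_hilbert_space)"
proof -
  have "complex_of_real ((norm (c *\<^sub>C x))\<^sup>2) = c * cnj c * complex_of_real ((norm x)\<^sup>2)"
    unfolding cinner_self[symmetric] by (simp add: cinner_scaleC_left cinner_scaleC_right mult_ac)
  also have "\<dots> = complex_of_real ((cmod c * norm x)\<^sup>2)"
    by (simp only: complex_norm_square[symmetric] power_mult_distrib of_real_mult)
  finally have "(norm (c *\<^sub>C x))\<^sup>2 = (cmod c * norm x)\<^sup>2"
    by (simp only: of_real_eq_iff)
  then show ?thesis
    by simp
qed

lemma bounded_linear_scaleC: "bounded_linear (\<lambda>x::'a::complex_hilbert_space. c *\<^sub>C x)"
  by (rule bounded_linear_intro[where K="cmod c"])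
    (simp_all add: scaleC_add_right scaleR_scaleC scaleC_scaleC norm_scaleC mult_ac)

section \<open>Closures of subspaces and orthogonal projections\<close>

lemma csubspace_closure:
  fixes M :: "'a::complex_hilbert_space set"
  assumes "complex_vector.subspace M"
  shows "complex_vector.subspace (closure M)"
proof (rule complex_vector.subspaceI)
  show "0 \<in> closure M"
    using assms closure_subset complex_vector.subspace_0 by blast
next
  fix x y assume "x \<in> closure M" "y \<in> closure M"
  then obtain a b where "\<And>n. a n \<in> M" "a \<longlonglongrightarrow> x" "\<And>n. b n \<in> M" "b \<longlonglongrightarrow> y"
    unfolding closure_sequential by blast
  then show "x + y \<in> closure M"
    unfolding closure_sequential
    by (intro exI[of _ "\<lambda>n. a n + b n"])
      (auto intro: tendsto_add complex_vector.subspace_add[OF assms])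
next
  fix c x assume "x \<in> closure M"
  then obtain a where "\<And>n. a n \<in> M" "a \<longlonglongrightarrow> x"
    unfolding closure_sequential by blast
  then show "c *\<^sub>C x \<in> closure M"
    unfolding closure_sequential
    by (intro exI[of _ "\<lambda>n. c *\<^sub>C a n"])
      (auto intro: bounded_linear.tendsto[OF bounded_linear_scaleC]
        complex_vector.subspace_scale[OF assms])
qed

text \<open>Both residuals are orthogonal to \<open>M\<close>, hence so is \<open>P x - p\<close>,
  which itself lies in \<open>M\<close> and is therefore orthogonal to itself. The identities for
  projections below are obtained by checking this characterization.\<close>

lemma projection_eqI:
  assumes "is_orthogonal_projection P M" "complex_vector.subspace M"
    and "p \<in> M" "\<And>y. y \<in> M \<Longrightarrow> cinner y (x - p) = 0"
  shows "P x = p"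
proof -
  have P: "P x \<in> M" "\<And>y. y \<in> M \<Longrightarrow> cinner y (x - P x) = 0"
    using assms(1) by (auto simp: is_orthogonal_projection_def)
  have d: "P x - p \<in> M"
    using P assms by (simp add: complex_vector.subspace_diff)
  have "cinner (P x - p) (P x - p) = cinner (P x - p) (x - p) - cinner (P x - p) (x - P x)"
    by (simp flip: cinner_diff_right)
  also have "\<dots> = 0"
    using P(2)[OF d] assms(4)[OF d] by simp
  finally show ?thesis
    by (simp add: cinner_self_eq_0_iff)
qed

lemma projection_add:
  assumes "is_orthogonal_projection P M" "complex_vector.subspace M"
  shows "P (x + y) = P x + P y"
proof (rule projection_eqI[OF assms])
  show "P x + P y \<in> M"
    using assms by (auto simp: is_orthogonal_projection_def complex_vector.subspace_add)
  show "cinner z (x + y - (P x + P y)) = 0" if "z \<in> M" for z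
    using assms that
    by (simp add: is_orthogonal_projection_def add_diff_add cinner_add_right)
qed

lemma projection_scaleC:
  assumes "is_orthogonal_projection P M" "complex_vector.subspace M"
  shows "P (c *\<^sub>C x) = c *\<^sub>C P x"
proof (rule projection_eqI[OF assms])
  show "c *\<^sub>C P x \<in> M"
    using assms by (auto simp: is_orthogonal_projection_def complex_vector.subspace_scale)
  show "cinner z (c *\<^sub>C x - c *\<^sub>C P x) = 0" if "z \<in> M" for z
    using assms that
    by (simp add: is_orthogonal_projection_def cinner_scaleC_right
        flip: complex_vector.scale_right_diff_distrib)
qed

lemma projection_norm_le:
  assumes "is_orthogonal_projection P M"
  shows "norm (P x) \<le> norm x"
proof -
  have "inner (P x) (x - P x) = 0"
    using assms by (simp add: is_orthogonal_projection_def inner_eq_Re_cinner)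
  then have "(norm x)\<^sup>2 = (norm (P x))\<^sup>2 + (norm (x - P x))\<^sup>2"
    using norm_add_Pythagorean[of "P x" "x - P x"] by (simp add: orthogonal_def)
  then show ?thesis
    by (simp add: power2_le_imp_le)
qed

lemma projection_bounded_clinear:
  assumes "is_orthogonal_projection P M" "complex_vector.subspace M"
  shows "bounded_clinear P"
  unfolding bounded_clinear_def
proof (intro conjI allI)
  show "bounded_linear P"
    by (rule bounded_linear_intro[where K=1])
      (simp_all add: projection_add[OF assms] projection_scaleC[OF assms] scaleR_scaleC
        projection_norm_le[OF assms(1)])
qed (rule projection_scaleC[OF assms])

section \<open>Eigenspaces and the adjoint\<close>

lemma csubspace_eigenspace:
  assumes "bounded_clinear A"
  shows "complex_vector.subspace (eigenspace A c)"
proof -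
  interpret bounded_linear A
    using assms by (simp add: bounded_clinear_def)
  have "A (d *\<^sub>C x) = d *\<^sub>C A x" for d x
    using assms by (simp add: bounded_clinear_def)
  then show ?thesis
    by (auto simp: eigenspace_def add zero scaleC_add_right complex_vector.scale_left_commute
        intro!: complex_vector.subspaceI)
qed

text \<open>\<open>B\<close> is given only through the adjoint relation; its homogeneity follows
  because a vector orthogonal to every \<open>y\<close> is zero.\<close>

lemma is_cadjoint_scaleC:
  assumes "is_cadjoint B A"
  shows "B (c *\<^sub>C x) = c *\<^sub>C B x"
proof -
  have adj: "cinner (B x) y = cinner x (A y)" for x y
    using assms by (simp add: is_cadjoint_def)
  have "cinner (B (c *\<^sub>C x) - c *\<^sub>C B x) y = 0" for y
    by (simp add: cinner_diff_left cinner_scaleC_left adj)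
  then show ?thesis
    using cinner_self_eq_0_iff eq_iff_diff_eq_0 by blast
qed

text \<open>\<open>B\<close> names a witness of the existential in \<open>normal_operator\<close>,
  so that the adjoint is available throughout.\<close>

locale normal_decomposition =
  fixes A B :: "'a::complex_hilbert_space \<Rightarrow> 'a"
    and S :: "nat set" and lam :: "nat \<Rightarrow> complex" and P :: "nat \<Rightarrow> 'a \<Rightarrow> 'a"
  assumes bounded_clinear_A: "bounded_clinear A"
    and cadjoint: "is_cadjoint B A"
    and commute: "A \<circ> B = B \<circ> A"
    and decomposition: "canonical_decomposition A S lam P"
begin

sublocale A: bounded_linear A
  using bounded_clinear_A by (simp add: bounded_clinear_def)

lemma A_scaleC: "A (c *\<^sub>C x) = c *\<^sub>C A x"
  using bounded_clinear_A by (simp add: bounded_clinear_def)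

lemma cinner_B: "cinner (B x) y = cinner x (A y)"
  using cadjoint by (simp add: is_cadjoint_def)

text \<open>Since \<open>B\<close> commutes with \<open>A\<close>, it preserves the eigenspace, so
  the defect \<open>w\<close> is again an eigenvector or zero. Moving \<open>B\<close> across the
  inner product gives \<open>cinner w w = cinner x (A w - c *\<^sub>C w) = 0\<close>.\<close>

lemma adjoint_eigenvector:
  assumes "x \<in> eigenspace A c"
  shows "B x = cnj c *\<^sub>C x"
proof -
  have Ax: "A x = c *\<^sub>C x"
    using assms by (simp add: eigenspace_def)
  have AB: "A (B x) = B (A x)"
    using commute by (metis comp_apply)
  define w where "w = B x - cnj c *\<^sub>C x"
  have "A w = c *\<^sub>C w"
    by (simp add: w_def A.diff A_scaleC AB Ax is_cadjoint_scaleC[OF cadjoint]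
        complex_vector.scale_right_diff_distrib complex_vector.scale_left_commute)
  then have "cinner w w = 0"
    by (subst (1) w_def) (simp add: cinner_diff_left cinner_scaleC_left cinner_scaleC_right cinner_B)
  then show ?thesis
    by (simp add: cinner_self_eq_0_iff w_def)
qed

section \<open>Eigenvalues and spectral projections\<close>

lemma zero_in_S: "0 \<in> S" and lam_0: "lam 0 = 0"
  using decomposition by (auto simp: canonical_decomposition_def)

lemma lam_nonzero: "n \<in> S \<Longrightarrow> n \<noteq> 0 \<Longrightarrow> lam n \<noteq> 0"
  using decomposition by (auto simp: canonical_decomposition_def bij_betw_def)

lemma inj_on_lam: "inj_on lam S"
proof -
  have "inj_on lam (S - {0})"
    using decomposition by (simp add: canonical_decomposition_def bij_betw_def)
  then show ?thesis
    using lam_nonzero lam_0 unfolding inj_on_def by (metis Diff_iff singletonD)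
qed

text \<open>If \<open>S\<close> is infinite, \<open>lam\<close> tends to 0 along the indices in
  \<open>S\<close>, so only an initial segment of them can have modulus at least
  \<open>r\<close>.\<close>

lemma finite_lam_ge:
  assumes "0 < r"
  shows "finite {n \<in> S. r \<le> cmod (lam n)}"
proof (cases "finite S")
  case False
  then have "(lam \<longlongrightarrow> 0) (inf sequentially (principal S))"
    using decomposition by (simp add: canonical_decomposition_def)
  then have "\<forall>\<^sub>F n in sequentially. n \<in> S \<longrightarrow> cmod (lam n) < r"
    using assms by (auto simp: tendsto_iff eventually_inf_principal)
  then obtain N where "\<And>n. n \<ge> N \<Longrightarrow> n \<in> S \<Longrightarrow> cmod (lam n) < r"
    unfolding eventually_sequentially by blast
  then have "{n \<in> S. r \<le> cmod (lam n)} \<subseteq> {..<N}"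
    by (metis (mono_tags, lifting) lessThan_iff linorder_not_less mem_Collect_eq subsetI)
  then show ?thesis
    using finite_subset by blast
qed simp

lemma projection: "n \<in> S \<Longrightarrow> is_orthogonal_projection (P n) (eigenspace A (lam n))"
  using decomposition by (simp add: canonical_decomposition_def)

lemma bounded_clinear_P: "n \<in> S \<Longrightarrow> bounded_clinear (P n)"
  using projection_bounded_clinear[OF projection csubspace_eigenspace[OF bounded_clinear_A]] .

lemma bounded_linear_P: "n \<in> S \<Longrightarrow> bounded_linear (P n)"
  and P_scaleC: "n \<in> S \<Longrightarrow> P n (c *\<^sub>C x) = c *\<^sub>C P n x"
  using bounded_clinear_P by (auto simp: bounded_clinear_def)

lemmas P_diff = linear_diff[OF bounded_linear.linear[OF bounded_linear_P]]
  and P_sum = linear_sum[OF bounded_linear.linear[OF bounded_linear_P]]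

lemma P_eqI:
  assumes "n \<in> S" "p \<in> eigenspace A (lam n)"
    and "\<And>y. y \<in> eigenspace A (lam n) \<Longrightarrow> cinner y (x - p) = 0"
  shows "P n x = p"
  using projection_eqI[OF projection csubspace_eigenspace[OF bounded_clinear_A]] assms by blast

lemma P_in_eigenspace: "n \<in> S \<Longrightarrow> P n x \<in> eigenspace A (lam n)"
  and cinner_P_diff: "n \<in> S \<Longrightarrow> y \<in> eigenspace A (lam n) \<Longrightarrow> cinner y (x - P n x) = 0"
  using projection by (auto simp: is_orthogonal_projection_def)

lemma A_P: "n \<in> S \<Longrightarrow> A (P n x) = lam n *\<^sub>C P n x"
  using P_in_eigenspace by (simp add: eigenspace_def)

text \<open>This is where normality enters: for \<open>y\<close> in the eigenspace,
  \<open>B y = cnj (lam n) *\<^sub>C y\<close>, so the residual of \<open>A x\<close> against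
  \<open>y\<close> is \<open>lam n\<close> times that of \<open>x\<close>, which is zero.\<close>

lemma P_A:
  assumes n: "n \<in> S"
  shows "P n (A x) = lam n *\<^sub>C P n x"
proof (rule P_eqI[OF n])
  show "lam n *\<^sub>C P n x \<in> eigenspace A (lam n)"
    using P_in_eigenspace[OF n] csubspace_eigenspace[OF bounded_clinear_A]
      complex_vector.subspace_scale by blast
  fix y assume y: "y \<in> eigenspace A (lam n)"
  have "cinner y (A x - lam n *\<^sub>C P n x) = lam n * cinner y (x - P n x)"
    using adjoint_eigenvector[OF y]
    by (simp add: cinner_diff_right cinner_scaleC_right cinner_scaleC_left algebra_simps
        flip: cinner_B)
  then show "cinner y (A x - lam n *\<^sub>C P n x) = 0"
    using cinner_P_diff[OF n y] by simp
qed

lemma P_A_power: "n \<in> S \<Longrightarrow> P n ((A ^^ k) x) = (lam n ^ k) *\<^sub>C P n x"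
  by (induction k) (simp_all add: P_A scaleC_scaleC scaleC_one)

text \<open>Evaluating \<open>cinner y (A x)\<close> on either side gives the factors
  \<open>lam j\<close> and \<open>lam i\<close>, which differ.\<close>

lemma eigenspaces_orthogonal:
  assumes "i \<in> S" "j \<in> S" "i \<noteq> j" "y \<in> eigenspace A (lam i)" "x \<in> eigenspace A (lam j)"
  shows "cinner y x = 0"
proof -
  have "lam j * cinner y x = cinner y (A x)"
    using assms(5) by (simp add: eigenspace_def cinner_scaleC_right)
  also have "\<dots> = lam i * cinner y x"
    using adjoint_eigenvector[OF assms(4)] by (simp add: cinner_scaleC_left flip: cinner_B)
  moreover have "lam i \<noteq> lam j"
    using inj_on_lam assms by (auto dest: inj_onD)
  ultimately show ?thesis
    by simp
qed

lemma P_P: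
  assumes "i \<in> S" "j \<in> S"
  shows "P i (P j x) = (if i = j then P j x else 0)"
proof (rule P_eqI[OF assms(1)])
  show "(if i = j then P j x else 0) \<in> eigenspace A (lam i)"
    using P_in_eigenspace assms by (auto simp: eigenspace_def A.zero)
  show "cinner y (P j x - (if i = j then P j x else 0)) = 0" if "y \<in> eigenspace A (lam i)" for y
    using eigenspaces_orthogonal[OF assms _ that P_in_eigenspace] assms by simp
qed

section \<open>Orthogonal sums, Bessel's inequality and expansions\<close>

lemma norm_sum_scaleC_P:
  assumes "finite F" "F \<subseteq> S"
  shows "(norm (\<Sum>n\<in>F. c n *\<^sub>C P n x))\<^sup>2 = (\<Sum>n\<in>F. (cmod (c n))\<^sup>2 * (norm (P n x))\<^sup>2)"
proof -
  have "orthogonal (c i *\<^sub>C P i x) (c j *\<^sub>C P j x)" if "i \<in> F" "j \<in> F" "i \<noteq> j" for i j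
  proof -
    have "cinner (P i x) (P j x) = 0"
      using eigenspaces_orthogonal[of i j] P_in_eigenspace that assms by blast
    then show ?thesis
      by (simp add: orthogonal_def inner_eq_Re_cinner cinner_scaleC_left cinner_scaleC_right)
  qed
  then have "pairwise (\<lambda>i j. orthogonal (c i *\<^sub>C P i x) (c j *\<^sub>C P j x)) F"
    by (simp add: pairwise_def)
  from norm_sum_Pythagorean[OF assms(1) this] show ?thesis
    by (simp add: norm_scaleC power_mult_distrib)
qed

text \<open>The remainder \<open>x - s\<close> is orthogonal to every \<open>P m x\<close> with
  \<open>m \<in> F\<close>, hence to their sum \<open>s\<close>; Pythagoras then gives the
  bound.\<close>

lemma bessel:
  assumes "finite F" "F \<subseteq> S"
  shows "(\<Sum>n\<in>F. (norm (P n x))\<^sup>2) \<le> (norm x)\<^sup>2"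
proof -
  define s where "s = (\<Sum>n\<in>F. P n x)"
  have "cinner (P m x) (x - s) = 0" if m: "m \<in> F" for m
  proof -
    have "P m s = P m x"
      using assms m by (simp add: s_def P_sum P_P subset_iff)
    then have "P m (x - s) = 0"
      using assms m by (simp add: P_diff subset_iff)
    then show ?thesis
      using cinner_P_diff[of m "P m x" "x - s"] P_in_eigenspace assms m by auto
  qed
  then have "cinner s (x - s) = 0"
    by (simp add: s_def cinner_sum_left)
  then have "(norm x)\<^sup>2 = (norm s)\<^sup>2 + (norm (x - s))\<^sup>2"
    using norm_add_Pythagorean[of s "x - s"] by (simp add: orthogonal_def inner_eq_Re_cinner)
  moreover have "(norm s)\<^sup>2 = (\<Sum>n\<in>F. (norm (P n x))\<^sup>2)"
    using norm_sum_scaleC_P[OF assms, of "\<lambda>_. 1" x] by (simp add: s_def scaleC_one)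
  ultimately show ?thesis
    by simp
qed

text \<open>Operator-norm convergence implies pointwise convergence, since the remainder
  \<open>D N\<close> is a bounded operator.\<close>

lemma A_expansion: "(\<lambda>N. \<Sum>n\<in>S \<inter> {..N}. lam n *\<^sub>C P n x) \<longlonglongrightarrow> A x"
proof -
  define D where "D N x = A x - (\<Sum>n\<in>S \<inter> {..N}. lam n *\<^sub>C P n x)" for N x
  have "bounded_linear (D N)" for N
    unfolding D_def
    by (intro bounded_linear_sub bounded_linear_sum A.bounded_linear_axioms
        bounded_linear_compose[OF bounded_linear_scaleC] bounded_linear_P) simp
  then have "norm (D N x) \<le> onorm (D N) * norm x" for N
    by (rule onorm)
  moreover have "(\<lambda>N. onorm (D N) * norm x) \<longlonglongrightarrow> 0"
    using decomposition unfolding canonical_decomposition_def D_def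
    by (auto intro: tendsto_mult_left_zero)
  ultimately have "(\<lambda>N. D N x) \<longlonglongrightarrow> 0"
    by (rule Lim_null_comparison[OF always_eventually[OF allI]])
  from tendsto_diff[OF tendsto_const[of "A x"] this] show ?thesis
    by (simp add: D_def)
qed

text \<open>Pythagoras and Bessel bound every partial sum of the expansion of \<open>A x\<close>.
  Only indices with \<open>P n x \<noteq> 0\<close> contribute, so a vector whose large components
  vanish gets a bound smaller than the operator norm may be.\<close>

lemma norm_A_le:
  assumes "0 \<le> r" and "\<And>n. n \<in> S \<Longrightarrow> P n x \<noteq> 0 \<Longrightarrow> cmod (lam n) \<le> r"
  shows "norm (A x) \<le> r * norm x"
proof (rule LIMSEQ_le_const2[OF tendsto_norm[OF A_expansion]], intro exI allI impI)
  fix N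
  have "(norm (\<Sum>n\<in>S \<inter> {..N}. lam n *\<^sub>C P n x))\<^sup>2
      = (\<Sum>n\<in>S \<inter> {..N}. (cmod (lam n))\<^sup>2 * (norm (P n x))\<^sup>2)"
    by (rule norm_sum_scaleC_P) auto
  also have "\<dots> \<le> (\<Sum>n\<in>S \<inter> {..N}. r\<^sup>2 * (norm (P n x))\<^sup>2)"
  proof (rule sum_mono)
    fix n assume "n \<in> S \<inter> {..N}"
    then show "(cmod (lam n))\<^sup>2 * (norm (P n x))\<^sup>2 \<le> r\<^sup>2 * (norm (P n x))\<^sup>2"
      using assms by (cases "P n x = 0") (auto intro!: mult_right_mono power_mono)
  qed
  also have "\<dots> \<le> (r * norm x)\<^sup>2"
    using bessel[of "S \<inter> {..N}" x]
    by (simp add: power_mult_distrib mult_left_mono flip: sum_distrib_left)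
  finally show "norm (\<Sum>n\<in>S \<inter> {..N}. lam n *\<^sub>C P n x) \<le> r * norm x"
    by (rule power2_le_imp_le) (simp add: assms(1))
qed

lemma resolution_of_identity: "(\<lambda>N. \<Sum>n\<in>S \<inter> {..N}. P n x) \<longlonglongrightarrow> x"
proof -
  define h where "h N = (\<Sum>n\<in>S \<inter> {..N}. P n x)" for N
  define a where "a N = (\<Sum>n\<in>S \<inter> {..N}. (norm (P n x))\<^sup>2)" for N
  have "incseq a"
    unfolding a_def by (intro incseq_SucI sum_mono2) auto
  moreover have "a N \<le> (norm x)\<^sup>2" for N
    unfolding a_def by (rule bessel) auto
  ultimately have "Cauchy a"
    using incseq_convergent[of a] by (metis LIMSEQ_imp_Cauchy)
  \<comment> \<open>By Pythagoras, squared distances of the partial sums \<open>h\<close> are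
    distances of the real partial sums \<open>a\<close>, so the Cauchy property passes from
    \<open>a\<close> to \<open>h\<close>.\<close>
  have dist: "(dist (h m) (h n))\<^sup>2 = dist (a m) (a n)" if "n \<le> m" for m n
  proof -
    let ?D = "S \<inter> {..m} - S \<inter> {..n}"
    have "h m - h n = (\<Sum>k\<in>?D. P k x)" and "a m - a n = (\<Sum>k\<in>?D. (norm (P k x))\<^sup>2)"
      unfolding h_def a_def using that by (subst sum_diff; auto)+
    then show ?thesis
      using norm_sum_scaleC_P[of ?D "\<lambda>_. 1" x]
      by (simp add: Diff_subset[THEN subset_trans] dist_norm scaleC_one sum_nonneg)
  qed
  have "Cauchy h"
  proof (rule metric_CauchyI)
    fix e :: real assume "0 < e"
    then obtain N where N: "\<And>m n. m \<ge> N \<Longrightarrow> n \<ge> N \<Longrightarrow> dist (a m) (a n) < e\<^sup>2"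
      using \<open>Cauchy a\<close> unfolding Cauchy_def by (meson zero_less_power)
    have "dist (h m) (h n) < e" if "m \<ge> N" "n \<ge> N" for m n
    proof (rule power2_less_imp_less)
      show "(dist (h m) (h n))\<^sup>2 < e\<^sup>2"
        using dist[of n m] dist[of m n] N[OF that] by (metis dist_commute nle_le)
    qed (use \<open>0 < e\<close> in simp)
    then show "\<exists>N. \<forall>m\<ge>N. \<forall>n\<ge>N. dist (h m) (h n) < e"
      by blast
  qed
  then obtain y where y: "h \<longlonglongrightarrow> y"
    using Cauchy_convergent convergent_def by blast
  have "A (h N) = (\<Sum>n\<in>S \<inter> {..N}. lam n *\<^sub>C P n x)" for N
    by (simp add: h_def A.sum A_P)
  then have "A y = A x"
    using A.tendsto[OF y] A_expansion[of x] LIMSEQ_unique by simp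
  \<comment> \<open>As \<open>lam 0 = 0\<close>, this eigenspace is the kernel of \<open>A\<close>,
    and \<open>P 0\<close> fixes \<open>x - y\<close>.\<close>
  then have "x - y \<in> eigenspace A (lam 0)"
    by (simp add: eigenspace_def lam_0 A.diff)
  then have "P 0 (x - y) = x - y"
    by (intro P_eqI[OF zero_in_S]) auto
  \<comment> \<open>The index 0 lies in \<open>S \<inter> {..N}\<close> for every \<open>N\<close>,
    so each partial sum already contains the whole kernel component of \<open>x\<close>.\<close>
  moreover have "P 0 (h N) = P 0 x" for N
    using zero_in_S by (simp add: h_def P_sum P_P)
  then have "P 0 y = P 0 x"
    using bounded_linear.tendsto[OF bounded_linear_P[OF zero_in_S] y]
    by (simp add: LIMSEQ_const_iff)
  ultimately have "x = y"
    by (simp add: P_diff[OF zero_in_S])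
  then show ?thesis
    using y unfolding h_def by blast
qed

section \<open>Spectral components of vectors in invariant subspaces\<close>

lemma eliminate_components:
  assumes M: "complex_vector.subspace M" "A ` M \<subseteq> M" and "x \<in> M"
    and "m \<in> S" "finite F" "F \<subseteq> S - {m}"
  shows "\<exists>u\<in>M. P m u = P m x \<and> (\<forall>j\<in>F. P j u = 0)"
  using \<open>finite F\<close> \<open>F \<subseteq> S - {m}\<close>
proof induction
  case empty
  then show ?case
    using \<open>x \<in> M\<close> by auto
next
  case (insert j F)
  then obtain u where u: "u \<in> M" "P m u = P m x" "\<And>i. i \<in> F \<Longrightarrow> P i u = 0"
    by auto
  have j: "j \<in> S" "lam m \<noteq> lam j"
    using insert.prems inj_on_lam \<open>m \<in> S\<close> by (auto dest: inj_onD)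
  \<comment> \<open>A Lagrange factor in \<open>A\<close>: it multiplies component \<open>i\<close>
    by \<open>(lam i - lam j) / (lam m - lam j)\<close>, which is 0 for \<open>i = j\<close> and 1
    for \<open>i = m\<close>. Components already removed stay zero.\<close>
  define v where "v = (1 / (lam m - lam j)) *\<^sub>C (A u - lam j *\<^sub>C u)"
  have Pv: "P i v = ((lam i - lam j) / (lam m - lam j)) *\<^sub>C P i u" if "i \<in> S" for i
    using that
    by (simp add: v_def P_scaleC P_diff P_A scaleC_scaleC
        flip: complex_vector.scale_left_diff_distrib)
  have "v \<in> M"
    using u M by (auto simp: v_def intro!: complex_vector.subspace_scale complex_vector.subspace_diff)
  moreover have "P m v = P m x"
    using j u \<open>m \<in> S\<close> by (simp add: Pv scaleC_one)
  moreover have "P i v = 0" if "i \<in> insert j F" for i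
    using that insert.prems u(3) j by (subst Pv) auto
  ultimately show ?case
    by blast
qed

text \<open>Power iteration: once all other components of modulus at least
  \<open>cmod (lam m)\<close> are removed, component \<open>m\<close> strictly dominates the rest,
  and rescaled powers of \<open>A\<close> isolate it.\<close>

lemma P_mem_invariant_nonzero:
  assumes M: "closed M" "complex_vector.subspace M" "A ` M \<subseteq> M" and "x \<in> M"
    and m: "m \<in> S" "m \<noteq> 0"
  shows "P m x \<in> M"
proof -
  define R where "R = cmod (lam m)"
  have R: "0 < R"
    using lam_nonzero m by (simp add: R_def)
  \<comment> \<open>The cutoff \<open>R / 2\<close> leaves finitely many indices, so the moduli
    below \<open>R\<close> have a maximum and cannot accumulate at \<open>R\<close>.\<close>
  define G where "G = {n \<in> S. R / 2 \<le> cmod (lam n)}"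
  have "finite G"
    using finite_lam_ge[of "R / 2"] R by (simp add: G_def)
  \<comment> \<open>Including \<open>R / 2\<close> keeps \<open>T\<close> nonempty and makes
    \<open>r\<close> a bound for the indices outside \<open>G\<close> as well.\<close>
  define T where "T = insert (R / 2) ((\<lambda>n. cmod (lam n)) ` {n \<in> G. cmod (lam n) < R})"
  define r where "r = Max T"
  have T: "finite T" "T \<noteq> {}" "\<forall>t\<in>T. t < R"
    using \<open>finite G\<close> R by (auto simp: T_def)
  have "r < R"
    using T by (simp add: r_def)
  have le_r: "t \<le> r" if "t \<in> T" for t
    unfolding r_def using T(1) that by (rule Max_ge)
  have r: "R / 2 \<le> r" "r < R" "\<And>n. n \<in> G \<Longrightarrow> cmod (lam n) < R \<Longrightarrow> cmod (lam n) \<le> r"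
    by (rule le_r, simp add: T_def) (fact, rule le_r, simp add: T_def)
  \<comment> \<open>Besides the larger eigenvalues, this contains the other eigenvalues of the same
    modulus as \<open>lam m\<close>, which rescaling would not damp.\<close>
  define F where "F = {n \<in> G. R \<le> cmod (lam n)} - {m}"
  have "finite F"
    using \<open>finite G\<close> by (simp add: F_def)
  moreover have "F \<subseteq> S - {m}"
    by (auto simp: F_def G_def)
  ultimately obtain u where u: "u \<in> M" "P m u = P m x" "\<And>j. j \<in> F \<Longrightarrow> P j u = 0"
    using eliminate_components[OF M(2,3) \<open>x \<in> M\<close> m(1)] by metis
  \<comment> \<open>An auxiliary remainder, not yet known to lie in \<open>M\<close>; the
    approximants \<open>w k\<close> are built from \<open>u\<close> instead.\<close>
  define v where "v = u - P m u"
  have "P n v = 0" if n: "n \<in> S" "r < cmod (lam n)" for n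
  proof (cases "n = m")
    case False
    have "n \<in> G" "R \<le> cmod (lam n)"
      using n r by (force simp: G_def)+
    then have "P n u = 0"
      using u(3) False by (simp add: F_def)
    then show ?thesis
      using n m False by (simp add: v_def P_diff P_P)
  qed (use m in \<open>simp add: v_def P_diff P_P\<close>)
  \<comment> \<open>Powers of \<open>A\<close> only rescale components, so no iterate of
    \<open>v\<close> acquires one with eigenvalue of modulus above \<open>r\<close>.\<close>
  then have "norm (A ((A ^^ k) v)) \<le> r * norm ((A ^^ k) v)" for k
    using r R by (intro norm_A_le) (auto simp: P_A_power intro: leI)
  then have v_le: "norm ((A ^^ k) v) \<le> r ^ k * norm v" for k
  proof (induction k)
    case (Suc k)
    have "norm ((A ^^ Suc k) v) \<le> r * norm ((A ^^ k) v)"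
      using Suc.prems by simp
    also have "\<dots> \<le> r * (r ^ k * norm v)"
      using Suc r R by (intro mult_left_mono) auto
    finally show ?case
      by (simp add: mult_ac)
  qed simp
  have u_power: "(A ^^ k) u = (A ^^ k) v + (lam m ^ k) *\<^sub>C P m u" for k
    by (induction k) (simp_all add: v_def scaleC_one A.add A_scaleC A_P m scaleC_scaleC mult_ac)
  define w where "w k = (1 / lam m ^ k) *\<^sub>C (A ^^ k) u" for k
  have "w k - P m u = (1 / lam m ^ k) *\<^sub>C (A ^^ k) v" for k
    using lam_nonzero m by (simp add: w_def u_power scaleC_add_right scaleC_scaleC scaleC_one)
  then have "norm (w k - P m u) \<le> (r / R) ^ k * norm v" for k
    using v_le[of k] R
    by (simp add: norm_scaleC norm_divide norm_power power_divide divide_right_mono flip: R_def)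
  moreover have "(\<lambda>k. (r / R) ^ k * norm v) \<longlonglongrightarrow> 0"
    using r R by (intro tendsto_mult_left_zero LIMSEQ_power_zero) simp
  ultimately have "(\<lambda>k. w k - P m u) \<longlonglongrightarrow> 0"
    by (rule Lim_null_comparison[OF always_eventually[OF allI]])
  then have "w \<longlonglongrightarrow> P m x"
    using u(2) LIM_zero_cancel by simp
  moreover have "(A ^^ k) u \<in> M" for k
    using u(1) M(3) by (induction k) auto
  then have "w k \<in> M" for k
    using M(2) by (simp add: w_def complex_vector.subspace_scale)
  ultimately show ?thesis
    using closed_sequentially[OF M(1)] by blast
qed

text \<open>The kernel component cannot be rescaled by \<open>lam 0 = 0\<close>; it is the limit of
  \<open>x\<close> minus finite sums of the other components, all of which are in
  \<open>M\<close>.\<close>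

lemma P_mem_invariant:
  assumes M: "closed M" "complex_vector.subspace M" "A ` M \<subseteq> M" and "x \<in> M" and "m \<in> S"
  shows "P m x \<in> M"
proof (cases "m = 0")
  case True
  have lim: "(\<lambda>N. x - (\<Sum>n\<in>S \<inter> {..N} - {0}. P n x)) \<longlonglongrightarrow> x - (x - P 0 x)"
  proof (intro tendsto_diff tendsto_const)
    have "(\<Sum>n\<in>S \<inter> {..N} - {0}. P n x) = (\<Sum>n\<in>S \<inter> {..N}. P n x) - P 0 x" for N
      using zero_in_S by (subst sum_diff1) auto
    then show "(\<lambda>N. \<Sum>n\<in>S \<inter> {..N} - {0}. P n x) \<longlonglongrightarrow> x - P 0 x"
      using tendsto_diff[OF resolution_of_identity tendsto_const] by simp
  qed
  have mem: "x - (\<Sum>n\<in>S \<inter> {..N} - {0}. P n x) \<in> M" for N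
    using P_mem_invariant_nonzero[OF M \<open>x \<in> M\<close>] \<open>x \<in> M\<close> M(2)
    by (intro complex_vector.subspace_diff complex_vector.subspace_sum) auto
  have "x - (x - P 0 x) \<in> M"
    using closed_sequentially[OF M(1) mem lim] .
  then show ?thesis
    using True by simp
qed (use P_mem_invariant_nonzero assms in blast)

section \<open>The closed Krylov subspace\<close>

lemma krylov_invariant: "A ` krylov A g \<subseteq> krylov A g"
proof (intro image_subsetI)
  fix x assume "x \<in> krylov A g"
  then show "A x \<in> krylov A g"
    unfolding krylov_def
  proof (induction rule: complex_vector.span_induct_alt)
    case (step c y z)
    then obtain k where "y = (A ^^ k) g"
      by blast
    then have "A y \<in> {(A ^^ k) g |k. True}"
      by (auto intro!: exI[of _ "Suc k"])
    then show ?case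
      using step by (simp add: A.add A_scaleC complex_vector.span_add
          complex_vector.span_scale complex_vector.span_base)
  qed (simp add: A.zero complex_vector.span_zero)
qed

lemma closure_krylov_invariant: "A ` closure (krylov A g) \<subseteq> closure (krylov A g)"
  using krylov_invariant closure_subset
  by (intro image_closure_subset A.continuous_on continuous_on_id closed_closure) blast

lemma closure_krylov_eq: "closure (krylov A g) = closure (cspan {P n g |n. n \<in> S})"
proof
  let ?C = "closure (cspan {P n g |n. n \<in> S})"
  have C: "complex_vector.subspace ?C"
    by (intro csubspace_closure complex_vector.subspace_span)
  have P: "P n g \<in> cspan {P n g |n. n \<in> S}" if "n \<in> S" for n
    using that by (auto intro: complex_vector.span_base)
  \<comment> \<open>The approximating sequence is the resolution of the identity at
    \<open>(A ^^ k) g\<close>, whose terms are the multiples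
    \<open>(lam n ^ k) *\<^sub>C P n g\<close>.\<close>
  have "(A ^^ k) g \<in> ?C" for k
    unfolding closure_sequential
  proof (intro exI conjI allI)
    have "P n ((A ^^ k) g) \<in> cspan {P n g |n. n \<in> S}" if "n \<in> S" for n
      using that P by (simp add: P_A_power complex_vector.span_scale)
    then show "(\<Sum>n\<in>S \<inter> {..N}. P n ((A ^^ k) g)) \<in> cspan {P n g |n. n \<in> S}" for N
      by (intro complex_vector.span_sum) auto
  qed (rule resolution_of_identity)
  then have "krylov A g \<subseteq> ?C"
    unfolding krylov_def by (intro complex_vector.span_minimal[OF _ C]) auto
  then show "closure (krylov A g) \<subseteq> ?C"
    by (simp add: closure_minimal)
next
  let ?K = "closure (krylov A g)"
  have K: "complex_vector.subspace ?K"
    unfolding krylov_def by (intro csubspace_closure complex_vector.subspace_span)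
  have "(A ^^ 0) g \<in> krylov A g"
    unfolding krylov_def by (intro complex_vector.span_base) blast
  then have "g \<in> ?K"
    using closure_subset by auto
  then have "P n g \<in> ?K" if "n \<in> S" for n
    using P_mem_invariant[OF closed_closure K closure_krylov_invariant _ that] by blast
  then have "cspan {P n g |n. n \<in> S} \<subseteq> ?K"
    by (intro complex_vector.span_minimal[OF _ K]) auto
  then show "closure (cspan {P n g |n. n \<in> S}) \<subseteq> ?K"
    by (simp add: closure_minimal)
qed

end

theorem proposition3p1:
  fixes A :: "'a::complex_hilbert_space \<Rightarrow> 'a"
    and S :: "nat set"
    and lam :: "nat \<Rightarrow> complex"
    and P :: "nat \<Rightarrow> 'a \<Rightarrow> 'a"
    and g :: 'a
  assumes "bounded_clinear A"
    and "compact_operator A"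
    and "normal_operator A"
    and "canonical_decomposition A S lam P"
  shows "closure (krylov A g) = closure (cspan {P n g | n. n \<in> S})"
proof -
  obtain B where "is_cadjoint B A" "A \<circ> B = B \<circ> A"
    using assms(3) by (auto simp: normal_operator_def)
  then interpret normal_decomposition A B S lam P
    using assms by unfold_locales
  show ?thesis
    by (rule closure_krylov_eq)
qed

end
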